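(* Let $\Omega=\mathbf{R}^d\setminus\{0\}$, so that $\Gamma=\{0\}$ and $d_\Gamma(x)=|x|$. Let $\delta,\delta'\geq0$, $c(s)=s^\delta(1+s)^{\delta'-\delta}$ for $s>0$, $c_\Omega(x)=c(|x|)$, and let $p\in[1,\infty)$ with $d+\delta\wedge\delta'-p>0$. Then the optimal constant $$\mu_p(\Omega)=\inf\Big\{\int_\Omega c_\Omega\,|\nabla\varphi|^p\Big/\int_\Omega c_\Omega\,d_\Gamma^{\,-p}\,|\varphi|^p:\ \varphi\in C_c^1(\Omega),\ \varphi\neq0\Big\}$$ in the weighted Hardy inequality on $\Omega$ is given by $\mu_p(\Omega)=\big((d+\delta\wedge\delta'-p)/p\big)^p$.
   Context: All functions are real-valued; $|\nabla\varphi|=(\sum_{k=1}^d|\partial_k\varphi|^2)^{1/2}$; $\delta\wedge\delta'=\min(\delta,\delta')$. *)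

theory Defs
  imports "HOL-Analysis.Analysis"
begin

definition partial_deriv :: "'n::finite \<Rightarrow> (real ^ 'n \<Rightarrow> real) \<Rightarrow> real ^ 'n \<Rightarrow> real"
  where "partial_deriv k \<phi> x = frechet_derivative \<phi> (at x) (axis k 1)"

definition grad_norm :: "(real ^ 'n::finite \<Rightarrow> real) \<Rightarrow> real ^ 'n \<Rightarrow> real"
  where "grad_norm \<phi> x = sqrt (\<Sum>k\<in>UNIV. \<bar>partial_deriv k \<phi> x\<bar>\<^sup>2)"

text \<open>
  A function in \<open>C\<^sub>c\<^sup>1(\<Omega>)\<close> is represented by its extension by zero to the whole space:
  the last two conjuncts force it to vanish outside a compact subset of \<open>\<Omega>\<close>.
\<close>
definition C1c :: "(real ^ 'n::finite) set \<Rightarrow> (real ^ 'n \<Rightarrow> real) set"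
  where "C1c \<Omega> = {\<phi>. (\<forall>x\<in>\<Omega>. \<phi> differentiable (at x)) \<and>
                     (\<forall>k. continuous_on \<Omega> (partial_deriv k \<phi>)) \<and>
                     compact (closure {x. \<phi> x \<noteq> 0}) \<and>
                     closure {x. \<phi> x \<noteq> 0} \<subseteq> \<Omega>}"

definition bdist :: "(real ^ 'n::finite) set \<Rightarrow> real ^ 'n \<Rightarrow> real"
  where "bdist \<Omega> x = infdist x (frontier \<Omega>)"

lemma bdist_punctured: "bdist (- {0}) x = norm x"
  for x :: "real ^ 'n::finite"
proof -
  have "frontier (- {0::real ^ 'n}) = {0}"
    by (simp only: frontier_complement) (simp add: frontier_def)
  then show ?thesis
    by (simp add: bdist_def)
qed

text \<open>
  The infimum is taken in the reals, so it means what it should because the set of quotients is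
  bounded below by \<open>0\<close> (for nonnegative \<open>w\<close>) and nonempty for nonempty open \<open>\<Omega>\<close>.
  For continuous weights the two integrands are continuous with compact support in \<open>\<Omega>\<close>, hence integrable.
\<close>
definition hardy_const :: "(real ^ 'n::finite \<Rightarrow> real) \<Rightarrow> real \<Rightarrow> (real ^ 'n) set \<Rightarrow> real"
  where "hardy_const w p \<Omega> =
    Inf {(LINT x:\<Omega>|lborel. w x * grad_norm \<phi> x powr p) /
         (LINT x:\<Omega>|lborel. w x * bdist \<Omega> x powr (- p) * \<bar>\<phi> x\<bar> powr p)
         | \<phi>. \<phi> \<in> C1c \<Omega> \<and> \<phi> \<noteq> (\<lambda>x. 0)}"

definition hardy_weight :: "real \<Rightarrow> real \<Rightarrow> real \<Rightarrow> real"
  where "hardy_weight \<delta> \<delta>' s = s powr \<delta> * (1 + s) powr (\<delta>' - \<delta>)"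

end

theory Submission
  imports Defs
begin

text \<open>
  Write \<open>d\<close> for the dimension, \<open>m = min \<delta> \<delta>'\<close>, \<open>c\<close> for the weight and \<open>A = (d + m - p) / p > 0\<close>, so that
  \<open>d + m = p * (A + 1)\<close>. The optimal constant is \<open>A powr p\<close>.

  Lower bound (\<open>Hardy_inequality\<close>). For \<open>\<phi>\<close> with compact support away from \<open>0\<close>, integration along rays gives
  \<open>\<bar>\<phi> x\<bar> \<le> \<integral>\<^sub>1\<^sup>\<infinity> \<bar>x\<bar> \<bar>\<nabla>\<phi>\<bar>(t x) dt\<close>. Thus \<open>\<phi>\<close> is dominated by a superposition of the functions
  \<open>x \<mapsto> \<bar>x\<bar> \<bar>\<nabla>\<phi>\<bar>(t x)\<close> with \<open>t \<ge> 1\<close>. In the \<open>L\<^sup>p\<close> norm with weight \<open>c(\<bar>x\<bar>) \<bar>x\<bar>\<^sup>-\<^sup>p\<close>, each of them is at most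
  the one with \<open>t = 1\<close>, whose norm is the \<open>p\<close>-th root of the numerator, times
  \<open>t powr (- (d + m) / p) = t powr (- A - 1)\<close>, because \<open>c(s / t) \<le> t powr (- m) * c s\<close>. Summing the norms gives
  the factor \<open>\<integral>\<^sub>1\<^sup>\<infinity> t powr (- A - 1) dt = 1 / A\<close>. The triangle inequality for the integral over \<open>t\<close> is obtained
  from Jensen's inequality (\<open>weighted_Jensen\<close>) and Tonelli's theorem.

  Upper bound (\<open>exists_near_minimizer\<close>). The function \<open>\<bar>x\<bar> powr (- A)\<close> has \<open>\<bar>\<nabla>\<phi>\<bar> = A * \<phi> / \<bar>x\<bar>\<close>, hence gives
  the quotient \<open>A powr p\<close>, but its integrals diverge. Where \<open>c s\<close> is comparable to \<open>s powr m\<close>, that is near \<open>0\<close>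
  if \<open>\<delta> \<le> \<delta>'\<close> and near infinity otherwise (\<open>hardy_weight_comparable\<close>), both integrands are comparable to
  \<open>\<bar>x\<bar> powr (- d)\<close>, the density of a dilation-invariant measure, so every dyadic shell contributes about equally.
  Truncating to \<open>n\<close> dyadic shells by scale-invariant ramps changes the integrals by a bounded amount, while the
  denominator grows like \<open>n\<close>; the quotients tend to \<open>A powr p\<close>.
\<close>

section \<open>Jensen's inequality for a power weight\<close>

text \<open>
  The tangent-line inequality for the convex function \<open>z \<mapsto> z powr p\<close> at \<open>y\<close>, which is Young's inequality
  for the product of \<open>z\<close> and \<open>y powr (p - 1)\<close>.
\<close>
lemma powr_tangent:
  fixes p y z :: real
  assumes "1 \<le> p" "0 < y" "0 \<le> z"
  shows "p * y powr (p - 1) * z \<le> z powr p + (p - 1) * y powr p"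
proof (cases "p = 1")
  case True
  then show ?thesis using assms by simp
next
  case False
  define q where "q = p / (p - 1)"
  have p: "p > 1" using False assms by simp
  have q: "q > 1" "1/p + 1/q = 1" using p by (auto simp: q_def field_simps)
  have "z * y powr (p - 1) \<le> z powr p / p + (y powr (p - 1)) powr q / q"
    using p q assms by (intro Youngs_inequality) auto
  also have "(y powr (p - 1)) powr q = y powr p"
    using p by (simp add: powr_powr q_def)
  finally show ?thesis using p by (simp add: q_def field_simps)
qed

text \<open>
  Jensen's inequality for the probability density \<open>A * t powr (- A - 1)\<close> on \<open>{1..}\<close>, applied to
  \<open>t powr (A + 1) * h t / A\<close>, whose mean is the integral of \<open>h\<close>. In the Hardy inequality it gives the
  triangle inequality for an integral of functions. It loses nothing in the constant, because along
  the extremal profile \<open>norm x powr (- A)\<close> the derivative decays exactly like \<open>t powr (- A - 1)\<close>.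
\<close>
lemma weighted_Jensen:
  fixes h :: "real \<Rightarrow> real" and p A T :: real
  assumes p: "1 \<le> p" and A: "0 < A"
    and h: "continuous_on {1..T} h" "\<And>t. t \<in> {1..T} \<Longrightarrow> 0 \<le> h t"
  shows "(integral {1..T} h) powr p
    \<le> A powr (1 - p) * integral {1..T} (\<lambda>t. t powr ((A + 1) * (p - 1)) * h t powr p)"
proof -
  define H where "H = integral {1..T} h"
  define J where "J = integral {1..T} (\<lambda>t. t powr ((A + 1) * (p - 1)) * h t powr p)"
  define W where "W = integral {1..T} (\<lambda>t. t powr (- A - 1))"
  define y where "y = A * H"
  have int_h: "h integrable_on {1..T}"
    by (rule integrable_continuous_interval[OF h(1)])
  have int_J: "(\<lambda>t. t powr ((A + 1) * (p - 1)) * h t powr p) integrable_on {1..T}"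
    using h p by (intro integrable_continuous_interval continuous_intros continuous_on_powr') auto
  have int_W: "(\<lambda>t. t powr (- A - 1)) integrable_on {1..T}"
    by (intro integrable_continuous_interval continuous_intros) auto
  have H0: "0 \<le> H" unfolding H_def using h by (intro integral_nonneg int_h) auto
  have J0: "0 \<le> J" unfolding J_def using h by (intro integral_nonneg int_J) auto
  have W: "W \<le> 1 / A"
  proof -
    have I: "((\<lambda>t. t powr (- A - 1)) has_integral 1 / A) {1..}"
      using has_integral_powr_to_inf[of "- A - 1" 1] A by simp
    have "W \<le> integral {1..} (\<lambda>t. t powr (- A - 1))"
      unfolding W_def using I int_W by (intro integral_subset_le) (auto simp: has_integral_integrable)
    then show ?thesis using I by (simp add: integral_unique)
  qed
  show ?thesis
  proof (cases "H = 0")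
    case True
    then show ?thesis using J0 unfolding H_def[symmetric] J_def[symmetric] by simp
  next
    case False
    then have y: "y > 0" using A H0 by (simp add: y_def)
    \<comment> \<open>The tangent is taken at the value \<open>y = A * H\<close> that makes equality hold for \<open>h t = y * t powr (- A - 1)\<close>.\<close>
    have pointwise: "p * y powr (p - 1) * h t
        \<le> t powr ((A + 1) * (p - 1)) * h t powr p + (p - 1) * y powr p * t powr (- A - 1)"
      if t: "t \<in> {1..T}" for t
    proof -
      have t0: "t > 0" using t by simp
      have "p * y powr (p - 1) * (h t * t powr (A + 1))
          \<le> (h t * t powr (A + 1)) powr p + (p - 1) * y powr p"
        using p y h(2)[OF t] by (intro powr_tangent) auto
      then have "t powr (- A - 1) * (p * y powr (p - 1) * (h t * t powr (A + 1)))
          \<le> t powr (- A - 1) * ((h t * t powr (A + 1)) powr p + (p - 1) * y powr p)"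
        by (intro mult_left_mono) auto
      moreover have "t powr (- A - 1) * (p * y powr (p - 1) * (h t * t powr (A + 1)))
          = p * y powr (p - 1) * h t"
        using t0 by (simp add: powr_diff powr_minus powr_add field_simps)
      moreover have "t powr (- A - 1) * (h t * t powr (A + 1)) powr p
          = t powr ((A + 1) * (p - 1)) * h t powr p"
        using t0 h(2)[OF t] by (simp add: powr_mult powr_powr algebra_simps flip: powr_add)
      ultimately show ?thesis by (simp only: distrib_left mult_ac)
    qed
    have "p * y powr (p - 1) * H \<le> J + (p - 1) * y powr p * W"
    proof (rule has_integral_le)
      show "((\<lambda>t. p * y powr (p - 1) * h t) has_integral p * y powr (p - 1) * H) {1..T}"
        unfolding H_def by (intro has_integral_mult_right integrable_integral int_h)
      show "((\<lambda>t. t powr ((A + 1) * (p - 1)) * h t powr p + (p - 1) * y powr p * t powr (- A - 1))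
          has_integral J + (p - 1) * y powr p * W) {1..T}"
        unfolding J_def W_def
        by (intro has_integral_add has_integral_mult_right integrable_integral int_J int_W)
    qed (rule pointwise)
    also have "\<dots> \<le> J + (p - 1) * y powr p * (1 / A)"
      using W p by (intro add_left_mono mult_left_mono) auto
    also have "y powr p = y powr (p - 1) * (A * H)"
      using y by (simp add: y_def[symmetric] powr_diff)
    finally have "y powr (p - 1) * H \<le> J"
      using A by (simp add: algebra_simps)
    moreover have "y powr (p - 1) * H = A powr (p - 1) * H powr p"
      using A H0 False by (simp add: y_def powr_mult powr_diff)
    ultimately have "A powr (1 - p) * (A powr (p - 1) * H powr p) \<le> A powr (1 - p) * J"
      by (intro mult_left_mono) auto
    moreover have "A powr (1 - p) * A powr (p - 1) = 1" using A by (simp flip: powr_add)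
    ultimately show ?thesis unfolding H_def J_def by (simp add: mult.assoc[symmetric])
  qed
qed

section \<open>Gradients of compactly supported functions on the punctured space\<close>

lemma grad_norm_eq: "grad_norm \<phi> x = norm (\<chi> k. partial_deriv k \<phi> x)"
  by (simp add: grad_norm_def norm_vec_def L2_set_def)

lemma grad_norm_nonneg: "0 \<le> grad_norm \<phi> x"
  by (simp add: grad_norm_eq)

lemma frechet_derivative_eq_inner:
  assumes "\<phi> differentiable (at x)"
  shows "frechet_derivative \<phi> (at x) v = v \<bullet> (\<chi> k. partial_deriv k \<phi> x)"
proof -
  have lin: "linear (frechet_derivative \<phi> (at x))"
    using assms by (rule linear_frechet_derivative)
  have "frechet_derivative \<phi> (at x) v = frechet_derivative \<phi> (at x) (\<Sum>k\<in>UNIV. v $ k *\<^sub>R axis k 1)"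
    using basis_expansion[of v] by (simp add: scalar_mult_eq_scaleR)
  also have "\<dots> = (\<Sum>k\<in>UNIV. v $ k * partial_deriv k \<phi> x)"
    by (simp add: linear_sum[OF lin] linear_scale[OF lin] partial_deriv_def)
  finally show ?thesis by (simp add: inner_vec_def)
qed

text \<open>
  A function supported in the punctured space vanishes near the origin as well, so it and its gradient
  are continuous on the whole space. The singular point thus causes no trouble for regularity or measurability.
\<close>
context
  fixes \<phi> :: "real ^ 'n::finite \<Rightarrow> real"
  assumes \<phi>: "\<phi> \<in> C1c (- {0})"
begin

lemma C1c_has_derivative_zero:
  assumes "x \<notin> closure {x. \<phi> x \<noteq> 0}"
  shows "(\<phi> has_derivative (\<lambda>_. 0)) (at x)"
proof (rule has_derivative_transform_within_open)
  show "((\<lambda>_. 0) has_derivative (\<lambda>_. 0)) (at x)" by simp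
  show "open (- closure {x. \<phi> x \<noteq> 0})" by (rule open_Compl) simp
  show "x \<in> - closure {x. \<phi> x \<noteq> 0}" using assms by simp
  show "0 = \<phi> x" if "x \<in> - closure {x. \<phi> x \<noteq> 0}" for x
    using that closure_subset[of "{x. \<phi> x \<noteq> 0}"] by auto
qed

lemma C1c_differentiable: "\<phi> differentiable (at x)"
proof (cases "x = 0")
  case True
  then show ?thesis
    using \<phi> C1c_has_derivative_zero[of 0] by (auto simp: C1c_def differentiable_def)
qed (use \<phi> in \<open>auto simp: C1c_def\<close>)

lemma C1c_partial_deriv_zero:
  assumes "x \<notin> closure {x. \<phi> x \<noteq> 0}"
  shows "partial_deriv k \<phi> x = 0"
  using frechet_derivative_at[OF C1c_has_derivative_zero[OF assms]]
  by (metis partial_deriv_def)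

lemma C1c_continuous: "continuous_on UNIV \<phi>"
  using C1c_differentiable
  by (simp add: continuous_on_eq_continuous_at differentiable_imp_continuous_within)

lemma C1c_partial_deriv_continuous: "continuous_on UNIV (partial_deriv k \<phi>)"
proof -
  let ?U = "- closure {x. \<phi> x \<noteq> 0}"
  have "continuous_on ?U (partial_deriv k \<phi>)"
    by (rule continuous_on_eq[of _ "\<lambda>_. 0"]) (simp_all add: C1c_partial_deriv_zero)
  moreover have "continuous_on (- {0}) (partial_deriv k \<phi>)"
    using \<phi> by (auto simp: C1c_def)
  ultimately have "continuous_on (?U \<union> - {0}) (partial_deriv k \<phi>)"
    by (intro continuous_on_open_Un open_Compl) auto
  moreover have "?U \<union> - {0} = UNIV" using \<phi> by (auto simp: C1c_def)
  ultimately show ?thesis by simp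
qed

lemma grad_norm_continuous: "continuous_on UNIV (grad_norm \<phi>)"
  unfolding grad_norm_def
  by (intro continuous_intros C1c_partial_deriv_continuous)

lemma grad_norm_zero:
  assumes "x \<notin> closure {x. \<phi> x \<noteq> 0}"
  shows "grad_norm \<phi> x = 0"
  using C1c_partial_deriv_zero[OF assms] by (simp add: grad_norm_def)

text \<open>
  The fundamental theorem of calculus along the ray from \<open>x\<close> away from the origin, stopped where \<open>\<phi>\<close>
  vanishes. Going outwards suits the case where the dimension plus the order of the weight exceeds \<open>p\<close>:
  the bounds obtained for the dilations by \<open>t\<close> are then integrable at infinity.
\<close>
lemma abs_le_integral_along_ray:
  assumes T: "1 \<le> T" and zero: "\<phi> (T *\<^sub>R x) = 0"
  shows "\<bar>\<phi> x\<bar> \<le> integral {1..T} (\<lambda>t. norm x * grad_norm \<phi> (t *\<^sub>R x))"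
proof -
  define f where "f = (\<lambda>t. frechet_derivative \<phi> (at (t *\<^sub>R x)) x)"
  have "((\<lambda>t. \<phi> (t *\<^sub>R x)) has_vector_derivative f t) (at t within {1..T})" for t
  proof -
    have "((\<lambda>t. \<phi> (t *\<^sub>R x)) has_derivative
        (\<lambda>h. frechet_derivative \<phi> (at (t *\<^sub>R x)) (h *\<^sub>R x))) (at t within {1..T})"
      by (rule has_derivative_compose[of "\<lambda>t. t *\<^sub>R x" "\<lambda>h. h *\<^sub>R x"])
        (use C1c_differentiable frechet_derivative_works in \<open>auto intro!: derivative_eq_intros\<close>)
    then show ?thesis
      using linear_scale[OF linear_frechet_derivative[OF C1c_differentiable]]
      by (simp add: has_vector_derivative_def f_def)
  qed
  then have "(f has_integral (\<phi> (T *\<^sub>R x) - \<phi> (1 *\<^sub>R x))) {1..T}"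
    using T by (intro fundamental_theorem_of_calculus) auto
  then have I: "(f has_integral (- \<phi> x)) {1..T}" using zero by simp
  have bound: "norm (f t) \<le> norm x * grad_norm \<phi> (t *\<^sub>R x)" for t
    unfolding f_def frechet_derivative_eq_inner[OF C1c_differentiable] grad_norm_eq
    using Cauchy_Schwarz_ineq2 by auto
  have "norm (integral {1..T} f) \<le> integral {1..T} (\<lambda>t. norm x * grad_norm \<phi> (t *\<^sub>R x))"
  proof (rule integral_norm_bound_integral)
    show "f integrable_on {1..T}" using I by blast
    show "(\<lambda>t. norm x * grad_norm \<phi> (t *\<^sub>R x)) integrable_on {1..T}"
      by (intro integrable_continuous_interval continuous_intros
          continuous_on_compose2[OF grad_norm_continuous]) auto
  qed (use bound in auto)
  then show ?thesis using I by (simp add: integral_unique)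
qed

lemma C1c_integrable:
  fixes f :: "real ^ 'n \<Rightarrow> real"
  assumes "continuous_on (- {0}) f" "\<And>x. x \<notin> closure {x. \<phi> x \<noteq> 0} \<Longrightarrow> f x = 0"
  shows "integrable lborel f"
proof -
  let ?K = "closure {x. \<phi> x \<noteq> 0}"
  have "compact ?K" "continuous_on ?K f"
    using \<phi> assms(1) by (auto simp: C1c_def intro: continuous_on_subset)
  then have "integrable lborel (\<lambda>x. indicator ?K x *\<^sub>R f x)"
    by (rule borel_integrable_compact)
  moreover have "(\<lambda>x. indicator ?K x *\<^sub>R f x) = f"
    using assms(2) by (intro ext) (auto simp: indicator_def simp del: of_bool_eq)
  ultimately show ?thesis by simp
qed

end

section \<open>The Hardy inequality\<close>

lemma nn_integral_dilation:
  fixes f :: "real ^ 'n::finite \<Rightarrow> ennreal"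
  assumes [measurable]: "f \<in> borel_measurable borel" and t: "0 < t"
  shows "(\<integral>\<^sup>+x. f x \<partial>lborel) = ennreal (t powr CARD('n)) * (\<integral>\<^sup>+x. f (t *\<^sub>R x) \<partial>lborel)"
proof -
  have "\<bar>t\<bar> ^ DIM(real ^ 'n) = t powr CARD('n)"
    using t by (simp add: powr_realpow)
  then show ?thesis
    using t by (subst lborel_affine[of t 0])
      (auto simp: nn_integral_density nn_integral_distr nn_integral_cmult)
qed

text \<open>
  The power \<open>p\<close> of the bound by the ray integral. The integral is extended from the stopping point to
  infinity so that the set of parameters \<open>t\<close> is the same for all \<open>x\<close>, as Tonelli's theorem requires.
\<close>
lemma ray_Jensen:
  fixes \<phi> :: "real ^ 'n::finite \<Rightarrow> real"
  assumes \<phi>: "\<phi> \<in> C1c (- {0})" and p: "1 \<le> p" and A: "0 < A" and x: "x \<noteq> 0"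
  shows "ennreal (norm x powr (- p) * \<bar>\<phi> x\<bar> powr p)
    \<le> (\<integral>\<^sup>+t. ennreal (A powr (1 - p) * t powr ((A + 1) * (p - 1)) * grad_norm \<phi> (t *\<^sub>R x) powr p)
          * indicator {1..} t \<partial>lborel)"
proof -
  define g where "g = grad_norm \<phi>"
  have g: "continuous_on UNIV g" "\<And>x. 0 \<le> g x"
    unfolding g_def by (auto intro: grad_norm_continuous[OF \<phi>] grad_norm_nonneg)
  obtain R where R: "\<And>y. y \<in> closure {x. \<phi> x \<noteq> 0} \<Longrightarrow> norm y \<le> R"
  proof -
    have "bounded (closure {x. \<phi> x \<noteq> 0})"
      using \<phi> by (simp add: C1c_def compact_imp_bounded)
    then show ?thesis using that unfolding bounded_iff by metis
  qed
  define T where "T = max 1 ((\<bar>R\<bar> + 1) / norm x)"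
  have T: "1 \<le> T" by (simp add: T_def)
  have "\<bar>R\<bar> + 1 \<le> T * norm x"
    using x by (simp add: T_def field_simps max_def)
  then have "T *\<^sub>R x \<notin> closure {x. \<phi> x \<noteq> 0}"
    using R[of "T *\<^sub>R x"] T by auto
  then have zero: "\<phi> (T *\<^sub>R x) = 0"
    using closure_subset[of "{x. \<phi> x \<noteq> 0}"] by auto
  let ?j = "\<lambda>t. t powr ((A + 1) * (p - 1)) * (norm x * g (t *\<^sub>R x)) powr p"
  let ?k = "\<lambda>t. A powr (1 - p) * t powr ((A + 1) * (p - 1)) * g (t *\<^sub>R x) powr p"
  have cont: "continuous_on {1..T} (\<lambda>t. norm x * g (t *\<^sub>R x))"
    by (intro continuous_intros continuous_on_compose2[OF g(1)]) auto
  have "\<bar>\<phi> x\<bar> powr p \<le> (integral {1..T} (\<lambda>t. norm x * g (t *\<^sub>R x))) powr p"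
    using p abs_le_integral_along_ray[OF \<phi> T zero] by (intro powr_mono2) (auto simp: g_def)
  also have "\<dots> \<le> A powr (1 - p) * integral {1..T} ?j"
    using p A g cont by (intro weighted_Jensen) auto
  also have "\<dots> = integral {1..T} (\<lambda>t. norm x powr p * ?k t)"
    using g(2) by (subst integral_mult_right[symmetric]) (simp add: powr_mult mult_ac)
  finally have "\<bar>\<phi> x\<bar> powr p \<le> norm x powr p * integral {1..T} ?k"
    by simp
  then have *: "norm x powr (- p) * \<bar>\<phi> x\<bar> powr p \<le> integral {1..T} ?k"
    using x by (simp add: powr_minus field_simps)
  have [measurable]: "g \<in> borel_measurable borel"
    using g(1) by (rule borel_measurable_continuous_onI)
  have "?k integrable_on {1..T}"
    using p g by (intro integrable_continuous_interval continuous_intros continuous_on_powr'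
        continuous_on_compose2[OF g(1)]) auto
  then have "(\<integral>\<^sup>+t. ennreal (indicator {1..T} t * ?k t) \<partial>lborel) = ennreal (integral {1..T} ?k)"
    by (intro nn_integral_has_integral_lebesgue) (auto simp: integrable_integral)
  then have "ennreal (norm x powr (- p) * \<bar>\<phi> x\<bar> powr p)
      \<le> (\<integral>\<^sup>+t. ennreal (indicator {1..T} t * ?k t) \<partial>lborel)"
    using * by (simp add: ennreal_leI)
  also have "\<dots> \<le> (\<integral>\<^sup>+t. ennreal (?k t) * indicator {1..} t \<partial>lborel)"
    by (intro nn_integral_mono) (auto simp: indicator_def)
  finally show ?thesis by (simp add: g_def)
qed

text \<open>
  Integrating the previous bound over \<open>x\<close> and exchanging the integrals, the substitution \<open>y = t *\<^sub>R x\<close>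
  produces \<open>t powr (- d)\<close> from the volume and at most \<open>t powr (- m)\<close> from the weight, where \<open>d\<close> is the
  dimension. Since \<open>d + m = p * (A + 1)\<close>, together with the factor from Jensen's inequality there remains
  \<open>A powr (1 - p) * t powr (- A - 1)\<close>, whose integral over \<open>{1..}\<close> is \<open>A powr (- p)\<close>.
\<close>
lemma Hardy_inequality:
  fixes \<phi> :: "real ^ 'n::finite \<Rightarrow> real" and w :: "real \<Rightarrow> real"
  assumes \<phi>: "\<phi> \<in> C1c (- {0})" and p: "1 \<le> p" and A: "0 < A"
    and A_eq: "p * A = real CARD('n) + m - p"
    and w[measurable]: "w \<in> borel_measurable borel" and w0: "\<And>s. 0 \<le> w s"
    and scale: "\<And>s t. 0 < s \<Longrightarrow> 1 \<le> t \<Longrightarrow> w (s / t) \<le> t powr (- m) * w s"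
  shows "ennreal (A powr p)
      * (\<integral>\<^sup>+x. ennreal (w (norm x) * norm x powr (- p) * \<bar>\<phi> x\<bar> powr p) \<partial>lborel)
    \<le> (\<integral>\<^sup>+x. ennreal (w (norm x) * grad_norm \<phi> x powr p) \<partial>lborel)"
proof -
  define g where "g = grad_norm \<phi>"
  define N where "N = (\<integral>\<^sup>+x. ennreal (w (norm x) * g x powr p) \<partial>lborel)"
  define k where "k = (\<lambda>t. A powr (1 - p) * t powr ((A + 1) * (p - 1)))"
  have g: "continuous_on UNIV g" "\<And>x. 0 \<le> g x"
    unfolding g_def by (auto intro: grad_norm_continuous[OF \<phi>] grad_norm_nonneg)
  have g_zero: "g 0 = 0"
    unfolding g_def using \<phi> by (intro grad_norm_zero) (auto simp: C1c_def)
  have \<phi>_zero: "\<phi> 0 = 0"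
    using \<phi> closure_subset[of "{x. \<phi> x \<noteq> 0}"] by (auto simp: C1c_def)
  have [measurable]: "g \<in> borel_measurable borel"
    using g(1) by (rule borel_measurable_continuous_onI)
  have inner: "(\<integral>\<^sup>+x. ennreal (k t * (w (norm x) * g (t *\<^sub>R x) powr p)) \<partial>lborel)
      \<le> ennreal (A powr (1 - p) * t powr (- A - 1)) * N" if t: "1 \<le> t" for t
  proof -
    have "ennreal (t powr CARD('n)) * (\<integral>\<^sup>+x. ennreal (w (norm x) * g (t *\<^sub>R x) powr p) \<partial>lborel)
        = (\<integral>\<^sup>+y. ennreal (w (norm y / t) * g y powr p) \<partial>lborel)"
      using t by (subst nn_integral_dilation[of _ t]) auto
    also have "\<dots> \<le> (\<integral>\<^sup>+y. ennreal (t powr (- m)) * ennreal (w (norm y) * g y powr p) \<partial>lborel)"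
    proof (intro nn_integral_mono)
      fix y :: "real ^ 'n"
      have "w (norm y / t) * g y powr p \<le> t powr (- m) * w (norm y) * g y powr p"
        using scale[OF _ t, of "norm y"] g_zero
        by (cases "y = 0") (auto intro!: mult_right_mono)
      then show "ennreal (w (norm y / t) * g y powr p)
          \<le> ennreal (t powr (- m)) * ennreal (w (norm y) * g y powr p)"
        using w0 by (simp add: ennreal_mult[symmetric] ennreal_leI mult.assoc)
    qed
    also have "\<dots> = ennreal (t powr (- m)) * N"
      unfolding N_def by (simp add: nn_integral_cmult)
    finally have le: "ennreal (t powr CARD('n))
        * (\<integral>\<^sup>+x. ennreal (w (norm x) * g (t *\<^sub>R x) powr p) \<partial>lborel) \<le> ennreal (t powr (- m)) * N" .
    have kt: "k t = k t * t powr (- real CARD('n)) * t powr CARD('n)"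
      using t by (simp add: powr_minus)
    have "(\<integral>\<^sup>+x. ennreal (k t * (w (norm x) * g (t *\<^sub>R x) powr p)) \<partial>lborel)
        = ennreal (k t) * (\<integral>\<^sup>+x. ennreal (w (norm x) * g (t *\<^sub>R x) powr p) \<partial>lborel)"
      using w0 by (simp add: ennreal_mult nn_integral_cmult k_def)
    also have "\<dots> = ennreal (k t * t powr (- real CARD('n))) * (ennreal (t powr CARD('n))
        * (\<integral>\<^sup>+x. ennreal (w (norm x) * g (t *\<^sub>R x) powr p) \<partial>lborel))"
      by (subst kt, subst ennreal_mult) (auto simp: k_def mult.assoc)
    also have "\<dots> \<le> ennreal (k t * t powr (- real CARD('n))) * (ennreal (t powr (- m)) * N)"
      by (intro mult_left_mono le) auto
    also have "\<dots> = ennreal (k t * t powr (- real CARD('n)) * t powr (- m)) * N"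
      by (simp add: ennreal_mult k_def mult.assoc)
    also have "k t * t powr (- real CARD('n)) * t powr (- m)
        = A powr (1 - p) * t powr ((A + 1) * (p - 1) - CARD('n) - m)"
      unfolding k_def by (simp add: powr_diff powr_minus divide_inverse)
    also have "(A + 1) * (p - 1) - CARD('n) - m = - A - 1"
      using A_eq by (simp add: algebra_simps)
    finally show ?thesis .
  qed
  have "(\<integral>\<^sup>+x. ennreal (w (norm x) * norm x powr (- p) * \<bar>\<phi> x\<bar> powr p) \<partial>lborel)
      \<le> (\<integral>\<^sup>+x. (\<integral>\<^sup>+t. ennreal (k t * (w (norm x) * g (t *\<^sub>R x) powr p)) * indicator {1..} t
            \<partial>lborel) \<partial>lborel)"
  proof (intro nn_integral_mono)
    fix x :: "real ^ 'n"
    show "ennreal (w (norm x) * norm x powr (- p) * \<bar>\<phi> x\<bar> powr p)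
      \<le> (\<integral>\<^sup>+t. ennreal (k t * (w (norm x) * g (t *\<^sub>R x) powr p)) * indicator {1..} t \<partial>lborel)"
    proof (cases "x = 0")
      case False
      have "ennreal (w (norm x) * norm x powr (- p) * \<bar>\<phi> x\<bar> powr p)
          = ennreal (w (norm x)) * ennreal (norm x powr (- p) * \<bar>\<phi> x\<bar> powr p)"
        using w0 by (simp add: ennreal_mult[symmetric] mult.assoc)
      also have "\<dots> \<le> ennreal (w (norm x))
          * (\<integral>\<^sup>+t. ennreal (k t * g (t *\<^sub>R x) powr p) * indicator {1..} t \<partial>lborel)"
        using ray_Jensen[OF \<phi> p A False] by (intro mult_left_mono) (auto simp: g_def k_def)
      also have "\<dots> = (\<integral>\<^sup>+t. ennreal (w (norm x))
          * (ennreal (k t * g (t *\<^sub>R x) powr p) * indicator {1..} t) \<partial>lborel)"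
        by (simp add: nn_integral_cmult k_def)
      also have "\<dots> = (\<integral>\<^sup>+t. ennreal (k t * (w (norm x) * g (t *\<^sub>R x) powr p))
          * indicator {1..} t \<partial>lborel)"
        using w0 by (simp add: ennreal_mult k_def mult_ac)
      finally show ?thesis .
    qed (simp add: \<phi>_zero)
  qed
  also have "\<dots> = (\<integral>\<^sup>+t. (\<integral>\<^sup>+x. ennreal (k t * (w (norm x) * g (t *\<^sub>R x) powr p)) * indicator {1..} t
            \<partial>lborel) \<partial>lborel)"
    by (intro lborel_pair.Fubini') (simp add: k_def)
  also have "\<dots> \<le> (\<integral>\<^sup>+t. ennreal (A powr (1 - p)) * N * ennreal (indicator {1..} t * t powr (- A - 1)) \<partial>lborel)"
    using inner by (intro nn_integral_mono) (auto simp: indicator_def ennreal_mult mult_ac)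
  also have "\<dots> = ennreal (A powr (1 - p)) * N
      * (\<integral>\<^sup>+t. ennreal (indicator {1..} t * t powr (- A - 1)) \<partial>lborel)"
    by (simp add: nn_integral_cmult)
  also have "(\<integral>\<^sup>+t. ennreal (indicator {1..} t * t powr (- A - 1)) \<partial>lborel) = ennreal (1 / A)"
    using has_integral_powr_to_inf[of "- A - 1" 1] A
    by (intro nn_integral_has_integral_lebesgue) auto
  finally have "(\<integral>\<^sup>+x. ennreal (w (norm x) * norm x powr (- p) * \<bar>\<phi> x\<bar> powr p) \<partial>lborel)
      \<le> ennreal (A powr (- p)) * N"
    using A by (simp add: powr_diff powr_minus mult_ac ennreal_mult[symmetric] field_simps
        flip: mult.assoc)
  then have "ennreal (A powr p)
      * (\<integral>\<^sup>+x. ennreal (w (norm x) * norm x powr (- p) * \<bar>\<phi> x\<bar> powr p) \<partial>lborel)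
      \<le> ennreal (A powr p) * (ennreal (A powr (- p)) * N)"
    by (intro mult_left_mono) auto
  also have "\<dots> = N"
    using A by (simp add: powr_minus ennreal_mult[symmetric] flip: mult.assoc)
  finally show ?thesis by (simp add: N_def g_def)
qed

lemma hardy_weight_nonneg: "0 \<le> hardy_weight \<delta> \<delta>' s"
  by (simp add: hardy_weight_def)

text \<open>
  The logarithmic derivative of the weight with respect to \<open>ln s\<close> lies between \<open>\<delta>\<close> and \<open>\<delta>'\<close>, so shrinking
  the argument by \<open>t\<close> gains at least \<open>t powr (- min \<delta> \<delta>')\<close>.
\<close>
lemma hardy_weight_scale:
  assumes "0 < s" "1 \<le> t"
  shows "hardy_weight \<delta> \<delta>' (s / t) \<le> t powr (- min \<delta> \<delta>') * hardy_weight \<delta> \<delta>' s"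
proof -
  have pow: "(s / t) powr \<delta> = s powr \<delta> * t powr (- \<delta>)"
    using assms by (simp add: powr_divide powr_minus field_simps)
  have "(1 + s / t) powr (\<delta>' - \<delta>) \<le> t powr (\<delta> - min \<delta> \<delta>') * (1 + s) powr (\<delta>' - \<delta>)"
  proof (cases "\<delta> \<le> \<delta>'")
    case True
    then show ?thesis using assms by (auto intro!: powr_mono2 simp: field_simps)
  next
    case False
    have "(1 + s / t) powr (\<delta>' - \<delta>) \<le> ((1 + s) / t) powr (\<delta>' - \<delta>)"
      using assms False by (intro powr_mono2') (auto simp: field_simps)
    also have "\<dots> = t powr (\<delta> - min \<delta> \<delta>') * (1 + s) powr (\<delta>' - \<delta>)"
      using assms False by (simp add: powr_divide powr_diff)
    finally show ?thesis .
  qed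
  then have "s powr \<delta> * t powr (- \<delta>) * (1 + s / t) powr (\<delta>' - \<delta>)
      \<le> s powr \<delta> * t powr (- \<delta>) * (t powr (\<delta> - min \<delta> \<delta>') * (1 + s) powr (\<delta>' - \<delta>))"
    by (intro mult_left_mono) auto
  also have "\<dots> = t powr (- min \<delta> \<delta>') * hardy_weight \<delta> \<delta>' s"
    using assms by (simp add: hardy_weight_def powr_diff powr_minus field_simps)
  finally show ?thesis by (simp add: hardy_weight_def pow)
qed

section \<open>Radial test functions\<close>

lemma has_real_derivative_max0_squared:
  fixes t :: real
  shows "((\<lambda>t. (max 0 t)\<^sup>2) has_real_derivative 2 * max 0 t) (at t)"
proof -
  consider "t < 0" | "t = 0" | "t > 0" by linarith
  then show ?thesis
  proof cases
    case 1
    have "((\<lambda>t. 0) has_real_derivative 2 * max 0 t) (at t)" using 1 by simp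
    then show ?thesis
      by (rule has_field_derivative_transform_within_open[of _ _ _ "{..<0}"]) (use 1 in auto)
  next
    case 3
    have "((\<lambda>t. t\<^sup>2) has_real_derivative 2 * max 0 t) (at t)"
      using 3 by (auto intro!: derivative_eq_intros)
    then show ?thesis
      by (rule has_field_derivative_transform_within_open[of _ _ _ "{0<..}"]) (use 3 in auto)
  next
    case 2
    have "((\<lambda>h. max 0 h) \<longlongrightarrow> max 0 (0::real)) (at 0)"
      by (intro tendsto_intros)
    moreover have "\<forall>\<^sub>F h in at (0::real). max 0 h = (max 0 h)\<^sup>2 / h"
      unfolding eventually_at by (auto simp: max_def power2_eq_square intro!: exI[of _ 1])
    ultimately have "((\<lambda>h. (max 0 h)\<^sup>2 / h) \<longlongrightarrow> 0) (at (0::real))"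
      using tendsto_cong by fastforce
    then show ?thesis using 2 by (simp add: DERIV_def)
  qed
qed

text \<open>
  Squared positive parts are the simplest \<open>C\<^sup>1\<close> functions that vanish on a half-line; composing two of them
  gives a \<open>C\<^sup>1\<close> step without any case distinction in its formula.
\<close>
lemma exists_C1_step:
  obtains \<psi> \<psi>' :: "real \<Rightarrow> real"
  where "\<And>u. (\<psi> has_real_derivative \<psi>' u) (at u)" "continuous_on UNIV \<psi>'"
    "\<And>u. 0 \<le> \<psi> u" "\<And>u. \<psi> u \<le> 1" "\<And>u. u \<le> 0 \<Longrightarrow> \<psi> u = 0" "\<And>u. 1 \<le> u \<Longrightarrow> \<psi> u = 1"
    "\<And>u. u \<le> 0 \<Longrightarrow> \<psi>' u = 0" "\<And>u. 1 \<le> u \<Longrightarrow> \<psi>' u = 0" "\<And>u. \<bar>\<psi>' u\<bar> \<le> 4"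
proof
  define \<psi> where "\<psi> = (\<lambda>u::real. 1 - (max 0 (1 - (max 0 u)\<^sup>2))\<^sup>2)"
  define \<psi>' where "\<psi>' = (\<lambda>u::real. 4 * max 0 (1 - (max 0 u)\<^sup>2) * max 0 u)"
  have large: "max 0 (1 - (max 0 u)\<^sup>2) = 0" if "1 \<le> u" for u :: real
  proof -
    have "1 \<le> u\<^sup>2" using that by simp
    then show ?thesis using that by simp
  qed
  show "(\<psi> has_real_derivative \<psi>' u) (at u)" for u
  proof -
    have "((\<lambda>u. 1 - (max 0 u)\<^sup>2) has_real_derivative - (2 * max 0 u)) (at u)"
      by (rule derivative_eq_intros has_real_derivative_max0_squared refl)+ simp
    from DERIV_chain2[OF has_real_derivative_max0_squared this]
    have "((\<lambda>u. (max 0 (1 - (max 0 u)\<^sup>2))\<^sup>2) has_real_derivative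
        2 * max 0 (1 - (max 0 u)\<^sup>2) * - (2 * max 0 u)) (at u)" .
    from DERIV_diff[OF DERIV_const[of 1] this] show ?thesis
      unfolding \<psi>_def \<psi>'_def by (simp add: mult_ac)
  qed
  show "continuous_on UNIV \<psi>'"
    unfolding \<psi>'_def by (intro continuous_intros)
  show "0 \<le> \<psi> u" for u unfolding \<psi>_def by (auto simp: max_def power_le_one)
  show "\<psi> u \<le> 1" for u unfolding \<psi>_def by simp
  show "\<psi> u = 0" if "u \<le> 0" for u using that unfolding \<psi>_def by simp
  show "\<psi> u = 1" if "1 \<le> u" for u using large[OF that] unfolding \<psi>_def by simp
  show "\<psi>' u = 0" if "u \<le> 0" for u using that unfolding \<psi>'_def by simp
  show "\<psi>' u = 0" if "1 \<le> u" for u using large[OF that] unfolding \<psi>'_def by simp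
  show "\<bar>\<psi>' u\<bar> \<le> 4" for u
  proof (cases "1 \<le> u")
    case True
    then show ?thesis using large unfolding \<psi>'_def by simp
  next
    case False
    have "max 0 (1 - (max 0 u)\<^sup>2) * max 0 u \<le> 1 * 1"
      using False by (intro mult_mono) auto
    then show ?thesis unfolding \<psi>'_def by (simp add: abs_mult)
  qed
qed

text \<open>
  The two ramps of the cutoff are rescaled copies of the same step, so \<open>s * \<eta>' s\<close> is bounded independently
  of \<open>r\<close> and \<open>R\<close>. This scale invariance is what keeps the cost of the cutoff bounded as \<open>R / r\<close> grows.
\<close>
lemma exists_C1_cutoff:
  fixes r R :: real
  assumes r: "0 < r" and rR: "2 * r \<le> R"
  obtains \<eta> \<eta>' :: "real \<Rightarrow> real"
  where "\<And>s. (\<eta> has_real_derivative \<eta>' s) (at s)" "continuous_on UNIV \<eta>'"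
    "\<And>s. 0 \<le> \<eta> s" "\<And>s. \<eta> s \<le> 1"
    "\<And>s. s \<le> r \<or> 2 * R \<le> s \<Longrightarrow> \<eta> s = 0" "\<And>s. s \<le> r \<or> 2 * R \<le> s \<Longrightarrow> \<eta>' s = 0"
    "\<And>s. 2 * r \<le> s \<Longrightarrow> s \<le> R \<Longrightarrow> \<eta> s = 1" "\<And>s. 2 * r \<le> s \<Longrightarrow> s \<le> R \<Longrightarrow> \<eta>' s = 0"
    "\<And>s. 0 < s \<Longrightarrow> \<bar>s * \<eta>' s\<bar> \<le> 16"
proof -
  obtain \<psi> \<psi>' :: "real \<Rightarrow> real"
    where \<psi>: "\<And>u. (\<psi> has_real_derivative \<psi>' u) (at u)" "continuous_on UNIV \<psi>'"
      "\<And>u. 0 \<le> \<psi> u" "\<And>u. \<psi> u \<le> 1" "\<And>u. u \<le> 0 \<Longrightarrow> \<psi> u = 0" "\<And>u. 1 \<le> u \<Longrightarrow> \<psi> u = 1"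
      "\<And>u. u \<le> 0 \<Longrightarrow> \<psi>' u = 0" "\<And>u. 1 \<le> u \<Longrightarrow> \<psi>' u = 0" "\<And>u. \<bar>\<psi>' u\<bar> \<le> 4"
    by (rule exists_C1_step) blast
  have R: "0 < R" using r rR by linarith
  define \<eta> where "\<eta> = (\<lambda>s. \<psi> (s / r - 1) * \<psi> (2 - s / R))"
  define \<eta>' where "\<eta>' = (\<lambda>s. \<psi>' (s / r - 1) / r * \<psi> (2 - s / R) - \<psi> (s / r - 1) * \<psi>' (2 - s / R) / R)"
  show ?thesis
  proof
    show "(\<eta> has_real_derivative \<eta>' s) (at s)" for s
    proof -
      have a: "((\<lambda>s. \<psi> (s / r - 1)) has_real_derivative \<psi>' (s / r - 1) * (1 / r)) (at s)"
        using r by (intro DERIV_chain2[OF \<psi>(1)]) (auto intro!: derivative_eq_intros)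
      have b: "((\<lambda>s. \<psi> (2 - s / R)) has_real_derivative \<psi>' (2 - s / R) * (- 1 / R)) (at s)"
        using R by (intro DERIV_chain2[OF \<psi>(1)]) (auto intro!: derivative_eq_intros)
      show ?thesis
        unfolding \<eta>_def \<eta>'_def using DERIV_mult[OF a b] by (simp add: algebra_simps)
    qed
    have "continuous_on UNIV \<psi>"
      using \<psi>(1) by (auto intro!: DERIV_continuous_on)
    then show "continuous_on UNIV \<eta>'"
      unfolding \<eta>'_def using r R \<psi>(2)
      by (intro continuous_intros continuous_on_compose2[of UNIV \<psi> UNIV "\<lambda>s. s / r - 1"]
          continuous_on_compose2[of UNIV \<psi> UNIV "\<lambda>s. 2 - s / R"]
          continuous_on_compose2[of UNIV \<psi>' UNIV "\<lambda>s. s / r - 1"]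
          continuous_on_compose2[of UNIV \<psi>' UNIV "\<lambda>s. 2 - s / R"]) auto
    show "0 \<le> \<eta> s" "\<eta> s \<le> 1" for s
      unfolding \<eta>_def using \<psi>(3,4) by (auto intro: mult_le_one)
    show "\<eta> s = 0" "\<eta>' s = 0" if "s \<le> r \<or> 2 * R \<le> s" for s
    proof -
      have "s / r - 1 \<le> 0 \<or> 2 - s / R \<le> 0" using that r R by (auto simp: field_simps)
      then show "\<eta> s = 0" "\<eta>' s = 0" unfolding \<eta>_def \<eta>'_def using \<psi>(5,7) by auto
    qed
    show "\<eta> s = 1" "\<eta>' s = 0" if "2 * r \<le> s" "s \<le> R" for s
    proof -
      have "1 \<le> s / r - 1" "1 \<le> 2 - s / R" using that r R by (auto simp: field_simps)
      then show "\<eta> s = 1" "\<eta>' s = 0" unfolding \<eta>_def \<eta>'_def using \<psi>(6,8) by auto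
    qed
    show "\<bar>s * \<eta>' s\<bar> \<le> 16" if s: "0 < s" for s
    proof -
      have bound: "\<bar>\<psi>' v * a * \<psi> u\<bar> \<le> 8" if "0 \<le> a" "a \<le> 2 \<or> \<psi>' v = 0" for a u v
      proof (cases "\<psi>' v = 0")
        case False
        then have "\<bar>\<psi>' v\<bar> * a * \<psi> u \<le> 4 * 2 * 1"
          using that \<psi>(3,4,9) by (intro mult_mono) auto
        then show ?thesis using that \<psi>(3) by (simp add: abs_mult)
      qed simp
      have "\<bar>\<psi>' (s / r - 1) * (s / r) * \<psi> (2 - s / R)\<bar> \<le> 8"
      proof (rule bound)
        show "s / r \<le> 2 \<or> \<psi>' (s / r - 1) = 0" using \<psi>(8)[of "s / r - 1"] by linarith
      qed (use s r in simp)
      moreover have "\<bar>\<psi>' (2 - s / R) * (s / R) * \<psi> (s / r - 1)\<bar> \<le> 8"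
      proof (rule bound)
        show "s / R \<le> 2 \<or> \<psi>' (2 - s / R) = 0" using \<psi>(7)[of "2 - s / R"] by linarith
      qed (use s R in simp)
      moreover have "s * \<eta>' s = \<psi>' (s / r - 1) * (s / r) * \<psi> (2 - s / R)
          - \<psi>' (2 - s / R) * (s / R) * \<psi> (s / r - 1)"
        unfolding \<eta>'_def by (simp add: algebra_simps)
      ultimately show ?thesis by linarith
    qed
  qed
qed

lemma radial_C1c:
  fixes F F' :: "real \<Rightarrow> real"
  assumes F: "\<And>s. 0 < s \<Longrightarrow> (F has_real_derivative F' s) (at s)"
    and F': "continuous_on {0<..} F'"
    and r: "0 < r" and supp: "\<And>s. s < r \<or> R < s \<Longrightarrow> F s = 0"
  shows "(\<lambda>x::real ^ 'n::finite. F (norm x)) \<in> C1c (- {0})"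
    and "x \<noteq> 0 \<Longrightarrow> grad_norm (\<lambda>x::real ^ 'n. F (norm x)) x = \<bar>F' (norm x)\<bar>"
proof -
  let ?\<phi> = "\<lambda>x::real ^ 'n. F (norm x)"
  have der: "(?\<phi> has_derivative (\<lambda>h. F' (norm x) * (h \<bullet> sgn x))) (at x)" if "x \<noteq> 0" for x
    using F[of "norm x"] that
    by (intro has_derivative_compose[OF has_derivative_norm])
      (auto simp: has_field_derivative_def)
  have pd: "partial_deriv k ?\<phi> x = F' (norm x) * sgn x $ k" if "x \<noteq> 0" for x k
    using fun_cong[OF frechet_derivative_at[OF der[OF that]], of "axis k 1"]
    by (simp add: partial_deriv_def inner_axis')
  show "grad_norm ?\<phi> x = \<bar>F' (norm x)\<bar>" if "x \<noteq> 0" for x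
  proof -
    have "(\<chi> k. partial_deriv k ?\<phi> x) = F' (norm x) *\<^sub>R sgn x"
      using pd[OF that] by (simp add: vec_eq_iff)
    then show ?thesis using that by (simp add: grad_norm_eq norm_sgn)
  qed
  have closed: "closure {x. ?\<phi> x \<noteq> 0} \<subseteq> {x. r \<le> norm x \<and> norm x \<le> R}"
  proof (rule closure_minimal)
    show "{x. ?\<phi> x \<noteq> 0} \<subseteq> {x. r \<le> norm x \<and> norm x \<le> R}"
      using supp by (auto simp: not_less[symmetric])
    show "closed {x :: real ^ 'n. r \<le> norm x \<and> norm x \<le> R}"
      by (intro closed_Collect_conj closed_Collect_le continuous_intros)
  qed
  have "bounded (closure {x. ?\<phi> x \<noteq> 0})"
    using closed by (intro boundedI[of _ R]) auto
  moreover have "continuous_on (- {0}) (partial_deriv k ?\<phi>)" for k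
  proof (rule continuous_on_eq)
    show "continuous_on (- {0}) (\<lambda>x::real ^ 'n. F' (norm x) * sgn x $ k)"
      by (intro continuous_intros continuous_on_compose2[OF F']) auto
  qed (use pd in auto)
  ultimately show "?\<phi> \<in> C1c (- {0})"
    using der closed r by (auto simp: C1c_def differentiable_def compact_eq_bounded_closed)
qed

section \<open>The scale-invariant mass of spherical shells\<close>

lemma nn_integral_pos_on_open:
  fixes f :: "real ^ 'n::finite \<Rightarrow> ennreal"
  assumes [measurable]: "f \<in> borel_measurable borel"
    and U: "open U" "x0 \<in> U" and pos: "\<And>x. x \<in> U \<Longrightarrow> 0 < f x"
  shows "0 < (\<integral>\<^sup>+x. f x \<partial>lborel)"
proof (rule ccontr)
  assume "\<not> ?thesis"
  then have "AE x in lborel. f x = 0"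
    by (subst nn_integral_0_iff_AE[symmetric]) (auto simp: not_less)
  then have "AE x in lborel. x \<notin> U"
    by eventually_elim (use pos in force)
  then have "U \<in> null_sets lborel"
    using U by (subst (asm) AE_iff_null_sets[symmetric]) auto
  then have "negligible U"
    by (simp add: negligible_iff_null_sets null_sets_completionI)
  then show False using open_not_negligible[OF U(1)] U(2) by auto
qed

definition shell :: "real \<Rightarrow> real \<Rightarrow> (real ^ 'n::finite) set"
  where "shell a b = {x. a \<le> norm x \<and> norm x < b}"

text \<open>
  The measure with density \<open>norm x powr (- d)\<close>, with \<open>d\<close> the dimension, is invariant under dilations. On
  shells it plays the role of the measure \<open>ds / s\<close> in polar coordinates: the mass of a shell depends only
  on the ratio of its radii, and a chain of \<open>n\<close> dyadic shells has \<open>n\<close> times the mass of one of them.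
\<close>
definition shell_mass :: "'n::finite itself \<Rightarrow> real \<Rightarrow> real \<Rightarrow> ennreal"
  where "shell_mass _ a b =
    (\<integral>\<^sup>+(x::real ^ 'n). ennreal (norm x powr (- real CARD('n))) * indicator (shell a b) x \<partial>lborel)"

lemma shell_measurable [measurable]: "shell a b \<in> sets borel"
  unfolding shell_def by measurable

lemma shell_mass_dilate:
  assumes "0 < t"
  shows "shell_mass TYPE('n::finite) (t * a) (t * b) = shell_mass TYPE('n) a b"
proof -
  have "shell_mass TYPE('n) (t * a) (t * b) = ennreal (t powr CARD('n)) *
      (\<integral>\<^sup>+(x::real ^ 'n). ennreal (norm (t *\<^sub>R x) powr (- real CARD('n)))
        * indicator (shell (t * a) (t * b)) (t *\<^sub>R x) \<partial>lborel)"
    unfolding shell_mass_def using assms by (intro nn_integral_dilation) auto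
  also have "\<dots> = ennreal (t powr CARD('n)) *
      (\<integral>\<^sup>+(x::real ^ 'n). ennreal (t powr (- real CARD('n)))
        * (ennreal (norm x powr (- real CARD('n))) * indicator (shell a b) x) \<partial>lborel)"
    using assms
    by (intro arg_cong[where f = "\<lambda>I. ennreal (t powr CARD('n)) * I"] nn_integral_cong)
      (auto simp: shell_def indicator_def powr_mult ennreal_mult'[symmetric])
  also have "\<dots> = ennreal (t powr CARD('n) * t powr (- real CARD('n))) * shell_mass TYPE('n) a b"
    unfolding shell_mass_def by (simp add: nn_integral_cmult ennreal_mult mult.assoc)
  also have "t powr CARD('n) * t powr (- real CARD('n)) = 1"
    using assms by (simp flip: powr_add)
  finally show ?thesis by simp
qed

lemma shell_mass_add:
  assumes "a \<le> b" "b \<le> c"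
  shows "shell_mass TYPE('n::finite) a c = shell_mass TYPE('n) a b + shell_mass TYPE('n) b c"
  unfolding shell_mass_def using assms
  by (subst nn_integral_add[symmetric]) (auto intro!: nn_integral_cong simp: shell_def indicator_def)

lemma shell_mass_dyadic:
  assumes "0 < r"
  shows "shell_mass TYPE('n::finite) r (2 ^ n * r) = of_nat n * shell_mass TYPE('n) 1 2"
proof (induction n)
  case 0
  show ?case by (simp add: shell_mass_def shell_def)
next
  case (Suc n)
  have "shell_mass TYPE('n) r (2 ^ Suc n * r) = shell_mass TYPE('n) r (2 ^ n * r)
      + shell_mass TYPE('n) (2 ^ n * r) (2 ^ Suc n * r)"
    using assms by (intro shell_mass_add) auto
  also have "shell_mass TYPE('n) (2 ^ n * r) (2 ^ Suc n * r) = shell_mass TYPE('n) 1 2"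
    using shell_mass_dilate[of "2 ^ n * r" 1 2, where 'n = 'n] assms by (simp add: mult_ac)
  finally show ?case using Suc.IH by (simp add: algebra_simps)
qed

lemma shell_mass_unit_finite: "shell_mass TYPE('n::finite) 1 2 < \<infinity>"
proof -
  have "shell_mass TYPE('n) 1 2 \<le> (\<integral>\<^sup>+x. indicator (ball 0 2 :: (real ^ 'n) set) x \<partial>lborel)"
    unfolding shell_mass_def
    by (intro nn_integral_mono)
      (auto simp: shell_def indicator_def powr_minus divide_simps ge_one_powr_ge_zero)
  also have "\<dots> < \<infinity>" using emeasure_lborel_ball_finite by simp
  finally show ?thesis .
qed

lemma shell_mass_unit_pos: "0 < shell_mass TYPE('n::finite) 1 2"
  unfolding shell_mass_def
proof (rule nn_integral_pos_on_open)
  show "open {x :: real ^ 'n. 1 < norm x \<and> norm x < 2}"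
    by (intro open_Collect_conj open_Collect_less continuous_intros)
  show "(3/2) *\<^sub>R axis (undefined::'n) 1 \<in> {x :: real ^ 'n. 1 < norm x \<and> norm x < 2}"
    by simp
  show "0 < ennreal (norm x powr (- real CARD('n))) * indicator (shell 1 2) x"
    if "x \<in> {x :: real ^ 'n. 1 < norm x \<and> norm x < 2}" for x :: "real ^ 'n"
    using that by (auto simp: shell_def)
qed simp

section \<open>Sharpness of the constant\<close>

lemma hardy_integrands_integrable:
  fixes \<phi> :: "real ^ 'n::finite \<Rightarrow> real"
  assumes \<phi>: "\<phi> \<in> C1c (- {0})" and p: "1 \<le> p" and w: "continuous_on {0<..} w"
  shows "integrable lborel (\<lambda>x. w (norm x) * grad_norm \<phi> x powr p)"
    and "integrable lborel (\<lambda>x. w (norm x) * norm x powr (- p) * \<bar>\<phi> x\<bar> powr p)"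
proof -
  have wn: "continuous_on (- {0}) (\<lambda>x::real ^ 'n. w (norm x))"
    by (intro continuous_on_compose2[OF w] continuous_intros) auto
  show "integrable lborel (\<lambda>x. w (norm x) * grad_norm \<phi> x powr p)"
  proof (rule C1c_integrable[OF \<phi>])
    show "continuous_on (- {0}) (\<lambda>x. w (norm x) * grad_norm \<phi> x powr p)"
      using p by (intro continuous_intros wn continuous_on_powr'
          continuous_on_subset[OF grad_norm_continuous[OF \<phi>]]) (auto simp: grad_norm_nonneg)
  qed (simp add: grad_norm_zero[OF \<phi>])
  show "integrable lborel (\<lambda>x. w (norm x) * norm x powr (- p) * \<bar>\<phi> x\<bar> powr p)"
  proof (rule C1c_integrable[OF \<phi>])
    show "continuous_on (- {0}) (\<lambda>x. w (norm x) * norm x powr (- p) * \<bar>\<phi> x\<bar> powr p)"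
      using p by (intro continuous_intros wn continuous_on_powr'
          continuous_on_subset[OF C1c_continuous[OF \<phi>]]) auto
    show "w (norm x) * norm x powr (- p) * \<bar>\<phi> x\<bar> powr p = 0"
      if "x \<notin> closure {x. \<phi> x \<noteq> 0}" for x
      using that closure_subset[of "{x. \<phi> x \<noteq> 0}"] by auto
  qed
qed

lemma hardy_denominator_pos:
  fixes \<phi> :: "real ^ 'n::finite \<Rightarrow> real"
  assumes \<phi>: "\<phi> \<in> C1c (- {0})" "\<phi> \<noteq> (\<lambda>x. 0)" and p: "1 \<le> p"
    and w: "continuous_on {0<..} w" and w_pos: "\<And>s. 0 < s \<Longrightarrow> 0 < w s"
  shows "0 < (LINT x|lborel. w (norm x) * norm x powr (- p) * \<bar>\<phi> x\<bar> powr p)"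
proof -
  let ?f = "\<lambda>x. w (norm x) * norm x powr (- p) * \<bar>\<phi> x\<bar> powr p"
  have f: "integrable lborel ?f"
    using \<phi> p w by (intro hardy_integrands_integrable)
  have zero: "\<phi> 0 = 0"
    using \<phi> closure_subset[of "{x. \<phi> x \<noteq> 0}"] by (auto simp: C1c_def)
  have f_pos: "0 < ?f x" if "\<phi> x \<noteq> 0" for x
    using that zero w_pos[of "norm x"] by (cases "x = 0") auto
  then have f_nonneg: "0 \<le> ?f x" for x by (cases "\<phi> x = 0") (auto simp: less_imp_le)
  obtain x0 where x0: "\<phi> x0 \<noteq> 0" using \<phi>(2) by auto
  have "0 < (\<integral>\<^sup>+x. ennreal (?f x) \<partial>lborel)"
  proof (rule nn_integral_pos_on_open)
    show "open {x. \<phi> x \<noteq> 0}"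
      by (intro open_Collect_neq C1c_continuous[OF \<phi>(1)] continuous_intros)
  qed (use f x0 f_pos in \<open>auto simp: borel_measurable_integrable\<close>)
  also have "\<dots> = ennreal (integral\<^sup>L lborel ?f)"
    using f f_nonneg by (intro nn_integral_eq_integral) auto
  finally show ?thesis by simp
qed

text \<open>
  For the profile \<open>\<phi> x = norm x powr (- A)\<close> one has \<open>\<bar>\<nabla>\<phi>\<bar> = A * \<phi> / norm x\<close>, so the two integrands are
  proportional with ratio \<open>A powr p\<close>. It is not admissible because its integrals diverge logarithmically where
  the weight is comparable to \<open>s powr m\<close>. Cutting it off at the radii \<open>r\<close> and \<open>2 * R\<close> costs at most
  the mass of the two dyadic ramp shells, whereas the \<open>n\<close> dyadic shells between the ramps contribute \<open>n\<close> such
  masses to the denominator. Only comparability of the weight with \<open>s powr m\<close> on the support matters,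
  since on the middle shells numerator and denominator are proportional whatever the weight is.
\<close>
lemma exists_near_minimizer:
  fixes w :: "real \<Rightarrow> real" and A C1 C2 m p r :: real and n :: nat
  assumes p: "1 \<le> p" and A: "0 < A" and A_eq: "p * A = real CARD('n) + m - p"
    and w: "continuous_on {0<..} w" and w_pos: "\<And>s. 0 < s \<Longrightarrow> 0 < w s"
    and C1: "0 < C1" and r: "0 < r" and n: "0 < n"
    and comparable: "\<And>s. r \<le> s \<Longrightarrow> s \<le> 4 * 2 ^ n * r \<Longrightarrow> C1 * s powr m \<le> w s \<and> w s \<le> C2 * s powr m"
  obtains \<phi> :: "real ^ 'n::finite \<Rightarrow> real"
  where "\<phi> \<in> C1c (- {0})" "\<phi> \<noteq> (\<lambda>x. 0)"
    "(LINT x|lborel. w (norm x) * grad_norm \<phi> x powr p)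
      \<le> (A powr p + 2 * (A + 16) powr p * C2 / (C1 * n))
        * (LINT x|lborel. w (norm x) * norm x powr (- p) * \<bar>\<phi> x\<bar> powr p)"
proof -
  define R where "R = 2 ^ n * (2 * r)"
  have R: "2 * r \<le> R" "2 * R = 4 * 2 ^ n * r"
    using r by (auto simp: R_def)
  obtain \<eta> \<eta>' :: "real \<Rightarrow> real"
    where \<eta>: "\<And>s. (\<eta> has_real_derivative \<eta>' s) (at s)" "continuous_on UNIV \<eta>'"
      "\<And>s. 0 \<le> \<eta> s" "\<And>s. \<eta> s \<le> 1"
      "\<And>s. s \<le> r \<or> 2 * R \<le> s \<Longrightarrow> \<eta> s = 0" "\<And>s. s \<le> r \<or> 2 * R \<le> s \<Longrightarrow> \<eta>' s = 0"
      "\<And>s. 2 * r \<le> s \<Longrightarrow> s \<le> R \<Longrightarrow> \<eta> s = 1" "\<And>s. 2 * r \<le> s \<Longrightarrow> s \<le> R \<Longrightarrow> \<eta>' s = 0"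
      "\<And>s. 0 < s \<Longrightarrow> \<bar>s * \<eta>' s\<bar> \<le> 16"
    by (rule exists_C1_cutoff[OF r R(1)]) blast
  have \<eta>_cont: "continuous_on UNIV \<eta>"
    using \<eta>(1) by (auto intro!: DERIV_continuous_on)
  define F where "F = (\<lambda>s. s powr (- A) * \<eta> s)"
  define F' where "F' = (\<lambda>s. s powr (- A - 1) * (s * \<eta>' s - A * \<eta> s))"
  define \<phi> where "\<phi> = (\<lambda>x::real ^ 'n. F (norm x))"
  have F_deriv: "(F has_real_derivative F' s) (at s)" if s: "0 < s" for s
  proof -
    have "((\<lambda>s. s powr (- A)) has_real_derivative (- A) * s powr (- A - 1)) (at s)"
      using s by (rule has_real_derivative_powr)
    from DERIV_mult[OF this \<eta>(1)] show ?thesis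
      unfolding F_def F'_def using s by (simp add: powr_diff field_simps)
  qed
  have F'_cont: "continuous_on {0<..} F'"
    unfolding F'_def
    by (intro continuous_intros continuous_on_subset[OF \<eta>_cont] continuous_on_subset[OF \<eta>(2)]) auto
  have F_supp: "F s = 0" if "s < r \<or> 2 * R < s" for s
    using \<eta>(5)[of s] that by (auto simp: F_def)
  have \<phi>_C1c: "\<phi> \<in> C1c (- {0})"
    unfolding \<phi>_def by (rule radial_C1c(1)[OF F_deriv F'_cont r]) (use F_supp in auto)
  have grad: "grad_norm \<phi> x = \<bar>F' (norm x)\<bar>" if "x \<noteq> 0" for x
    unfolding \<phi>_def by (rule radial_C1c(2)[OF F_deriv F'_cont r _ that]) (use F_supp in auto)
  have \<phi>_nonzero: "\<phi> \<noteq> (\<lambda>x. 0)"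
  proof
    assume "\<phi> = (\<lambda>x. 0)"
    then have "\<phi> ((2 * r) *\<^sub>R axis undefined 1) = 0" by simp
    then show False using r R(1) \<eta>(7)[of "2 * r"] by (simp add: \<phi>_def F_def)
  qed
  let ?num = "\<lambda>x. w (norm x) * grad_norm \<phi> x powr p"
  let ?den = "\<lambda>x. w (norm x) * norm x powr (- p) * \<bar>\<phi> x\<bar> powr p"
  let ?B = "(A + 16) powr p * C2"
  let ?h = "\<lambda>x::real ^ 'n. norm x powr (- real CARD('n))"
  define K where "K = enn2real (shell_mass TYPE('n) 1 2)"
  have K_eq: "shell_mass TYPE('n) 1 2 = ennreal K"
    unfolding K_def using shell_mass_unit_finite[where 'n = 'n] by simp
  have K: "0 < K"
    using shell_mass_unit_pos[where 'n = 'n] unfolding K_eq by simp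
  have C2: "0 < C2"
  proof -
    have "r \<le> 4 * 2 ^ n * r" using R r by linarith
    then have "C1 * r powr m \<le> C2 * r powr m"
      using comparable[of r] by linarith
    then show ?thesis using C1 r by simp
  qed
  \<comment> \<open>The common density of both integrands: \<open>p * (A + 1) = d + m\<close> makes their powers of \<open>s\<close> agree.\<close>
  define u where "u = (\<lambda>s. w s * s powr (- (real CARD('n) + m)))"
  have num_eq: "?num x = u (norm x) * \<bar>norm x * \<eta>' (norm x) - A * \<eta> (norm x)\<bar> powr p"
    if "x \<noteq> 0" for x
  proof -
    have "(- A - 1) * p = - (real CARD('n) + m)" using A_eq by (simp add: algebra_simps)
    then show ?thesis
      using that by (simp add: grad u_def F'_def abs_mult powr_mult powr_powr)
  qed
  have den_eq: "?den x = u (norm x) * \<eta> (norm x) powr p" if "x \<noteq> 0" for x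
  proof -
    have "- p + (- A) * p = - (real CARD('n) + m)" using A_eq by (simp add: algebra_simps)
    then have "norm x powr (- p) * norm x powr ((- A) * p) = norm x powr (- (real CARD('n) + m))"
      by (simp only: powr_add[symmetric])
    then show ?thesis
      using that \<eta>(3) by (simp add: \<phi>_def u_def F_def abs_mult powr_mult powr_powr)
  qed
  have u_bounds: "C1 * s powr (- real CARD('n)) \<le> u s" "u s \<le> C2 * s powr (- real CARD('n))"
    if "r \<le> s" "s \<le> 2 * R" for s
  proof -
    have "s powr m * s powr (- (real CARD('n) + m)) = s powr (- real CARD('n))"
      by (simp flip: powr_add)
    moreover have "C1 * s powr m * s powr (- (real CARD('n) + m)) \<le> u s"
      "u s \<le> C2 * s powr m * s powr (- (real CARD('n) + m))"
      unfolding u_def using comparable[of s] that R by (auto intro!: mult_right_mono)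
    ultimately show "C1 * s powr (- real CARD('n)) \<le> u s" "u s \<le> C2 * s powr (- real CARD('n))"
      by (simp_all add: mult.assoc)
  qed
  have u_nonneg: "0 \<le> u s" if "0 < s" for s
    unfolding u_def using w_pos[OF that] by simp
  have num_int: "integrable lborel ?num" and den_int: "integrable lborel ?den"
    using hardy_integrands_integrable[OF \<phi>_C1c p w] by auto
  have num_nonneg: "0 \<le> ?num x" for x
    using num_eq[of x] u_nonneg[of "norm x"] grad_norm_zero[OF \<phi>_C1c, of 0] \<phi>_C1c
    by (cases "x = 0") (auto simp: C1c_def)
  have den_nonneg: "0 \<le> ?den x" for x
    using den_eq[of x] u_nonneg[of "norm x"] by (cases "x = 0") auto
  have num_pointwise: "ennreal (?num x) \<le> ennreal (A powr p) * ennreal (?den x)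
      + ennreal ?B * (ennreal (?h x) * indicator (shell r (2 * r)) x
                     + ennreal (?h x) * indicator (shell R (2 * R)) x)" for x
  proof (cases "x = 0")
    case True
    then show ?thesis using grad_norm_zero[OF \<phi>_C1c, of 0] \<phi>_C1c by (auto simp: C1c_def)
  next
    case False
    define s where "s = norm x"
    have s: "0 < s" using False by (simp add: s_def)
    consider "s < r \<or> 2 * R \<le> s" | "2 * r \<le> s" "s < R"
      | "x \<in> shell r (2 * r) \<or> x \<in> shell R (2 * R)" "r \<le> s" "s \<le> 2 * R"
      using R r unfolding shell_def s_def by fastforce
    then show ?thesis
    proof cases
      case 1
      then have "\<eta> s = 0" "\<eta>' s = 0" using \<eta>(5,6)[of s] by auto
      then have "?num x = 0" unfolding num_eq[OF False] using p by (simp add: s_def)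
      then show ?thesis by (simp only: ennreal_0 zero_le)
    next
      case 2
      then have "\<eta> s = 1" "\<eta>' s = 0" using \<eta>(7,8)[of s] by auto
      then have "?num x = A powr p * ?den x"
        unfolding num_eq[OF False] den_eq[OF False] using A by (simp add: s_def)
      then have "ennreal (?num x) = ennreal (A powr p) * ennreal (?den x)"
        using den_nonneg[of x] by (simp only: ennreal_mult powr_ge_zero)
      then show ?thesis by simp
    next
      case 3
      have "A * \<eta> s \<le> A" using A \<eta>(4)[of s] by simp
      moreover have "0 \<le> A * \<eta> s" using A \<eta>(3)[of s] by simp
      ultimately have "\<bar>s * \<eta>' s - A * \<eta> s\<bar> \<le> A + 16" using \<eta>(9)[OF s] by linarith
      then have "\<bar>s * \<eta>' s - A * \<eta> s\<bar> powr p \<le> (A + 16) powr p"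
        using p by (intro powr_mono2) auto
      then have "?num x \<le> (C2 * ?h x) * (A + 16) powr p"
        unfolding num_eq[OF False] using u_bounds[OF 3(2,3)] u_nonneg[OF s] C2
        by (intro mult_mono) (auto simp: s_def)
      then have "ennreal (?num x) \<le> ennreal (?B * ?h x)"
        by (intro ennreal_leI) (simp add: mult_ac)
      also have "\<dots> = ennreal ?B * ennreal (?h x)"
        using C2 by (intro ennreal_mult) auto
      also have "\<dots> \<le> ennreal ?B * (ennreal (?h x) * indicator (shell r (2 * r)) x
                     + ennreal (?h x) * indicator (shell R (2 * R)) x)"
        using 3(1) by (intro mult_left_mono) auto
      finally show ?thesis by (simp add: add_increasing)
    qed
  qed
  have [measurable]: "?den \<in> borel_measurable borel"
    using borel_measurable_integrable[OF den_int] by simp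
  have unit_shells: "shell_mass TYPE('n) r (2 * r) = ennreal K"
    "shell_mass TYPE('n) R (2 * R) = ennreal K"
    using shell_mass_dilate[of r 1 2, where 'n = 'n] shell_mass_dilate[of R 1 2, where 'n = 'n]
      r R K_eq by (simp_all add: mult_ac)
  have den_int_nonneg: "0 \<le> integral\<^sup>L lborel ?den"
    using den_nonneg by (simp add: integral_nonneg_AE)
  have two_K: "ennreal K + ennreal K = ennreal (2 * K)"
    using K by (simp flip: ennreal_plus)
  have "ennreal (integral\<^sup>L lborel ?num) = (\<integral>\<^sup>+x. ennreal (?num x) \<partial>lborel)"
    using num_int num_nonneg by (simp add: nn_integral_eq_integral)
  also have "\<dots> \<le> (\<integral>\<^sup>+x. ennreal (A powr p) * ennreal (?den x)
      + ennreal ?B * (ennreal (?h x) * indicator (shell r (2 * r)) x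
                     + ennreal (?h x) * indicator (shell R (2 * R)) x) \<partial>lborel)"
    by (intro nn_integral_mono num_pointwise)
  also have "\<dots> = ennreal (A powr p) * (\<integral>\<^sup>+x. ennreal (?den x) \<partial>lborel)
      + ennreal ?B * (shell_mass TYPE('n) r (2 * r) + shell_mass TYPE('n) R (2 * R))"
    unfolding shell_mass_def by (simp add: nn_integral_add nn_integral_cmult)
  also have "\<dots> = ennreal (A powr p) * ennreal (integral\<^sup>L lborel ?den) + ennreal ?B * ennreal (2 * K)"
    unfolding unit_shells two_K using den_int den_nonneg by (simp add: nn_integral_eq_integral)
  also have "\<dots> = ennreal (A powr p * integral\<^sup>L lborel ?den + ?B * (2 * K))"
  proof -
    have "0 \<le> A powr p * integral\<^sup>L lborel ?den" "0 \<le> ?B * (2 * K)"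
      using K C2 den_int_nonneg by (auto intro!: mult_nonneg_nonneg)
    moreover have "ennreal (A powr p) * ennreal (integral\<^sup>L lborel ?den) = ennreal (A powr p * integral\<^sup>L lborel ?den)"
      by (rule ennreal_mult[symmetric, OF powr_ge_zero den_int_nonneg])
    moreover have "ennreal ?B * ennreal (2 * K) = ennreal (?B * (2 * K))"
      using K C2 by (intro ennreal_mult[symmetric]) auto
    ultimately show ?thesis by (simp only: ennreal_plus)
  qed
  finally have num_le: "integral\<^sup>L lborel ?num \<le> A powr p * integral\<^sup>L lborel ?den + ?B * (2 * K)"
    using K C2 den_int_nonneg by (subst (asm) ennreal_le_iff) auto
  have den_pointwise: "ennreal C1 * (ennreal (?h x) * indicator (shell (2 * r) R) x) \<le> ennreal (?den x)" for x
  proof (cases "x \<in> shell (2 * r) R")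
    case True
    then have x: "2 * r \<le> norm x" "norm x \<le> R" "x \<noteq> 0" using r by (auto simp: shell_def)
    have "C1 * ?h x \<le> ?den x"
      unfolding den_eq[OF x(3)] using u_bounds[of "norm x"] \<eta>(7)[OF x(1,2)] x r R by simp
    then show ?thesis using True C1 by (simp add: ennreal_mult'[symmetric] ennreal_leI)
  qed simp
  have "ennreal (C1 * (n * K)) = ennreal C1 * shell_mass TYPE('n) (2 * r) R"
    unfolding R_def using shell_mass_dyadic[of "2 * r" n, where 'n = 'n] r C1 K K_eq
    by (simp add: ennreal_mult ennreal_of_nat_eq_real_of_nat)
  also have "\<dots> = (\<integral>\<^sup>+x. ennreal C1 * (ennreal (?h x) * indicator (shell (2 * r) R) x) \<partial>lborel)"
    unfolding shell_mass_def by (simp add: nn_integral_cmult)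
  also have "\<dots> \<le> (\<integral>\<^sup>+x. ennreal (?den x) \<partial>lborel)"
    by (intro nn_integral_mono den_pointwise)
  also have "\<dots> = ennreal (integral\<^sup>L lborel ?den)"
    using den_int den_nonneg by (simp add: nn_integral_eq_integral)
  finally have den_ge: "C1 * (n * K) \<le> integral\<^sup>L lborel ?den"
    using den_int_nonneg by (subst (asm) ennreal_le_iff) auto
  have "?B * (2 * K) = 2 * ?B / (C1 * n) * (C1 * (n * K))"
    using C1 n by simp
  also have "\<dots> \<le> 2 * ?B / (C1 * n) * integral\<^sup>L lborel ?den"
    using den_ge C1 C2 by (intro mult_left_mono) auto
  finally have "integral\<^sup>L lborel ?num \<le> (A powr p + 2 * (A + 16) powr p * C2 / (C1 * n)) * integral\<^sup>L lborel ?den"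
    using num_le by (simp add: algebra_simps)
  with \<phi>_C1c \<phi>_nonzero show ?thesis by (rule that)
qed

text \<open>
  The weight behaves like \<open>s powr \<delta>\<close> near \<open>0\<close> and like \<open>s powr \<delta>'\<close> near infinity, so the smaller exponent is
  attained at one of the two ends. There the weight is comparable to \<open>s powr min \<delta> \<delta>'\<close> on arbitrarily long
  dyadic ranges: those ending at \<open>1\<close> if \<open>\<delta> \<le> \<delta>'\<close>, those starting at \<open>1\<close> otherwise.
\<close>
lemma hardy_weight_comparable:
  obtains C1 C2 :: real
  where "0 < C1"
    "\<And>n::nat. \<exists>r>0. \<forall>s. r \<le> s \<and> s \<le> 4 * 2 ^ n * r \<longrightarrow>
       C1 * s powr min \<delta> \<delta>' \<le> hardy_weight \<delta> \<delta>' s \<and> hardy_weight \<delta> \<delta>' s \<le> C2 * s powr min \<delta> \<delta>'"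
proof (cases "\<delta> \<le> \<delta>'")
  case True
  show ?thesis
  proof (rule that[of 1 "2 powr (\<delta>' - \<delta>)"])
    fix n :: nat
    have bounds: "1 * s powr min \<delta> \<delta>' \<le> hardy_weight \<delta> \<delta>' s
        \<and> hardy_weight \<delta> \<delta>' s \<le> 2 powr (\<delta>' - \<delta>) * s powr min \<delta> \<delta>'" if s: "0 < s" "s \<le> 1" for s
    proof -
      have "1 \<le> (1 + s) powr (\<delta>' - \<delta>)" "(1 + s) powr (\<delta>' - \<delta>) \<le> 2 powr (\<delta>' - \<delta>)"
        using s True by (auto intro!: powr_mono2 ge_one_powr_ge_zero)
      then have "s powr \<delta> * 1 \<le> s powr \<delta> * (1 + s) powr (\<delta>' - \<delta>)"
        "s powr \<delta> * (1 + s) powr (\<delta>' - \<delta>) \<le> s powr \<delta> * 2 powr (\<delta>' - \<delta>)"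
        by (intro mult_left_mono; simp)+
      then show ?thesis using True by (simp add: hardy_weight_def mult.commute)
    qed
    define r :: real where "r = 1 / (4 * 2 ^ n)"
    have r: "0 < r" "4 * 2 ^ n * r = 1" by (simp_all add: r_def)
    show "\<exists>r>0. \<forall>s. r \<le> s \<and> s \<le> 4 * 2 ^ n * r \<longrightarrow> 1 * s powr min \<delta> \<delta>' \<le> hardy_weight \<delta> \<delta>' s
        \<and> hardy_weight \<delta> \<delta>' s \<le> 2 powr (\<delta>' - \<delta>) * s powr min \<delta> \<delta>'"
    proof (rule exI[of _ r], intro conjI allI impI)
      show "0 < r" by (rule r(1))
      fix s assume "r \<le> s \<and> s \<le> 4 * 2 ^ n * r"
      then have "0 < s" "s \<le> 1" using r by linarith+
      then show "1 * s powr min \<delta> \<delta>' \<le> hardy_weight \<delta> \<delta>' s"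
        "hardy_weight \<delta> \<delta>' s \<le> 2 powr (\<delta>' - \<delta>) * s powr min \<delta> \<delta>'"
        using bounds[of s] by simp_all
    qed
  qed simp
next
  case False
  show ?thesis
  proof (rule that[of "2 powr (\<delta>' - \<delta>)" 1])
    fix n :: nat
    have "2 powr (\<delta>' - \<delta>) * s powr min \<delta> \<delta>' \<le> hardy_weight \<delta> \<delta>' s
        \<and> hardy_weight \<delta> \<delta>' s \<le> 1 * s powr min \<delta> \<delta>'" if s: "1 \<le> s" for s
    proof -
      have "(2 * s) powr (\<delta>' - \<delta>) \<le> (1 + s) powr (\<delta>' - \<delta>)" "(1 + s) powr (\<delta>' - \<delta>) \<le> s powr (\<delta>' - \<delta>)"
        using s False by (auto intro!: powr_mono2')
      then have "s powr \<delta> * (2 * s) powr (\<delta>' - \<delta>) \<le> s powr \<delta> * (1 + s) powr (\<delta>' - \<delta>)"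
        "s powr \<delta> * (1 + s) powr (\<delta>' - \<delta>) \<le> s powr \<delta> * s powr (\<delta>' - \<delta>)"
        by (auto intro!: mult_left_mono)
      moreover have "s powr \<delta> * s powr (\<delta>' - \<delta>) = s powr \<delta>'"
        using s by (simp flip: powr_add)
      moreover have "s powr \<delta> * (2 * s) powr (\<delta>' - \<delta>) = 2 powr (\<delta>' - \<delta>) * (s powr \<delta> * s powr (\<delta>' - \<delta>))"
        using s by (simp add: powr_mult)
      ultimately show ?thesis
        using False by (simp add: hardy_weight_def)
    qed
    then show "\<exists>r>0. \<forall>s. r \<le> s \<and> s \<le> 4 * 2 ^ n * r \<longrightarrow> 2 powr (\<delta>' - \<delta>) * s powr min \<delta> \<delta>' \<le> hardy_weight \<delta> \<delta>' s
        \<and> hardy_weight \<delta> \<delta>' s \<le> 1 * s powr min \<delta> \<delta>'"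
      by (intro exI[of _ 1]) auto
  qed simp
qed

lemma set_lebesgue_integral_punctured:
  fixes f :: "'a::euclidean_space \<Rightarrow> real"
  assumes "f 0 = 0"
  shows "(LINT x:- {0}|lborel. f x) = (LINT x|lborel. f x)"
  unfolding set_lebesgue_integral_def using assms
  by (intro Bochner_Integration.integral_cong) (auto simp: indicator_def)

theorem proposition4p1:
  fixes \<Omega> :: "(real ^ 'n::finite) set" and \<delta> \<delta>' p :: real
  assumes "\<Omega> = - {0}"
    and "\<delta> \<ge> 0" and "\<delta>' \<ge> 0"
    and "p \<ge> 1"
    and "real CARD('n) + min \<delta> \<delta>' - p > 0"
  shows "hardy_const (\<lambda>x. hardy_weight \<delta> \<delta>' (norm x)) p \<Omega>
           = ((real CARD('n) + min \<delta> \<delta>' - p) / p) powr p"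
proof -
  let ?w = "hardy_weight \<delta> \<delta>'"
  define A where "A = (real CARD('n) + min \<delta> \<delta>' - p) / p"
  have p: "1 \<le> p" and A: "0 < A" and A_eq: "p * A = real CARD('n) + min \<delta> \<delta>' - p"
    using assms by (auto simp: A_def)
  have w_cont: "continuous_on {0<..} ?w"
    unfolding hardy_weight_def by (intro continuous_intros) auto
  have w_pos: "0 < ?w s" if "0 < s" for s
    using that by (simp add: hardy_weight_def)
  have w_borel: "?w \<in> borel_measurable borel"
    unfolding hardy_weight_def by measurable
  define num where "num \<phi> = (LINT x|lborel. ?w (norm x) * grad_norm \<phi> x powr p)"
    for \<phi> :: "real ^ 'n \<Rightarrow> real"
  define den where "den \<phi> = (LINT x|lborel. ?w (norm x) * norm x powr (- p) * \<bar>\<phi> x\<bar> powr p)"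
    for \<phi> :: "real ^ 'n \<Rightarrow> real"
  define Q where "Q = {num \<phi> / den \<phi> | \<phi>. \<phi> \<in> C1c (- {0}) \<and> \<phi> \<noteq> (\<lambda>x. 0)}"
  have "hardy_const (\<lambda>x. ?w (norm x)) p \<Omega> = Inf Q"
  proof -
    have "(LINT x:- {0}|lborel. ?w (norm x) * grad_norm \<phi> x powr p) = num \<phi>
        \<and> (LINT x:- {0}|lborel. ?w (norm x) * bdist (- {0}) x powr (- p) * \<bar>\<phi> x\<bar> powr p) = den \<phi>"
      for \<phi> :: "real ^ 'n \<Rightarrow> real"
      unfolding num_def den_def bdist_punctured
      by (intro conjI set_lebesgue_integral_punctured) (simp_all add: hardy_weight_def)
    then show ?thesis unfolding hardy_const_def Q_def assms(1) by simp
  qed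
  also have "Inf Q = A powr p"
  proof (rule antisym)
    have den_pos: "0 < den \<phi>" if "\<phi> \<in> C1c (- {0})" "\<phi> \<noteq> (\<lambda>x. 0)" for \<phi>
      unfolding den_def using that p w_cont w_pos by (rule hardy_denominator_pos)
    have lower: "A powr p \<le> q" if q_Q: "q \<in> Q" for q
    proof -
      obtain \<phi> where \<phi>: "\<phi> \<in> C1c (- {0})" "\<phi> \<noteq> (\<lambda>x. 0)" and q: "q = num \<phi> / den \<phi>"
        using q_Q by (auto simp: Q_def)
      have "ennreal (A powr p) * ennreal (den \<phi>) \<le> ennreal (num \<phi>)"
        using Hardy_inequality[OF \<phi>(1) p A A_eq w_borel hardy_weight_nonneg hardy_weight_scale]
          hardy_integrands_integrable[OF \<phi>(1) p w_cont]
        unfolding num_def den_def by (simp add: nn_integral_eq_integral hardy_weight_nonneg)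
      then have "A powr p * den \<phi> \<le> num \<phi>"
        using den_pos[OF \<phi>] by (simp add: ennreal_mult'[symmetric] num_def hardy_weight_nonneg)
      then show ?thesis using den_pos[OF \<phi>] by (simp add: q field_simps)
    qed
    obtain C1 C2 :: real where C1: "0 < C1" and C: "\<And>n::nat. \<exists>r>0. \<forall>s. r \<le> s \<and> s \<le> 4 * 2 ^ n * r \<longrightarrow>
       C1 * s powr min \<delta> \<delta>' \<le> ?w s \<and> ?w s \<le> C2 * s powr min \<delta> \<delta>'"
      by (rule hardy_weight_comparable[of \<delta> \<delta>']) blast
    define c where "c = 2 * (A + 16) powr p * C2 / C1"
    have near: "\<exists>q\<in>Q. q \<le> A powr p + c / n" if n: "0 < n" for n :: nat
    proof -
      obtain r where r: "0 < r" "\<And>s. r \<le> s \<Longrightarrow> s \<le> 4 * 2 ^ n * r \<Longrightarrow>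
          C1 * s powr min \<delta> \<delta>' \<le> ?w s \<and> ?w s \<le> C2 * s powr min \<delta> \<delta>'"
        using C[of n] by blast
      obtain \<phi> :: "real ^ 'n \<Rightarrow> real" where \<phi>: "\<phi> \<in> C1c (- {0})" "\<phi> \<noteq> (\<lambda>x. 0)"
        and "num \<phi> \<le> (A powr p + 2 * (A + 16) powr p * C2 / (C1 * n)) * den \<phi>"
        unfolding num_def den_def
        by (rule exists_near_minimizer[OF p A A_eq w_cont w_pos C1 r(1) n r(2)])
      then have "num \<phi> / den \<phi> \<le> A powr p + c / n"
        using den_pos[OF \<phi>] by (simp add: c_def field_simps)
      moreover have "num \<phi> / den \<phi> \<in> Q" using \<phi> by (auto simp: Q_def)
      ultimately show ?thesis by blast
    qed
    show "A powr p \<le> Inf Q"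
      using near[of 1] lower by (intro cInf_greatest) auto
    have "Inf Q \<le> A powr p + c / n" if "0 < n" for n :: nat
      using near[OF that] lower by (meson bdd_belowI cInf_lower2)
    moreover have "(\<lambda>n. A powr p + c / real n) \<longlonglongrightarrow> A powr p + 0"
      by (intro tendsto_add tendsto_const lim_const_over_n)
    ultimately show "Inf Q \<le> A powr p"
      by (intro LIMSEQ_le_const[of "\<lambda>n. A powr p + c / real n"]) (auto intro!: exI[of _ 1])
  qed
  finally show ?thesis by (simp add: A_def)
qed

end
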